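(* Let $\mathbf{x}_1,\ldots,\mathbf{x}_n \in \mathbb{R}^p$ be nonzero data vectors for which Tyler's fixed-point equation $$\mathbf{V} = \frac{1}{n}\sum_{i=1}^n \frac{p}{\mathbf{x}_i^\top \mathbf{V}^{-1}\mathbf{x}_i}\,\mathbf{x}_i\mathbf{x}_i^\top$$ has a symmetric positive definite solution $\mathbf{V} \in \mathbb{R}^{p\times p}$ that is unique up to multiplication by a positive scalar. Let $\hat{\boldsymbol{\Sigma}}_{\mathrm{TWE}}(\{\mathbf{x}_i\})$ denote the Tyler's weights-based estimate (TWE) of the scatter matrix computed from $\mathbf{x}_1,\ldots,\mathbf{x}_n$. Then $\hat{\boldsymbol{\Sigma}}_{\mathrm{TWE}}$ is affine equivariant: for every invertible matrix $\mathbf{A} \in \mathbb{R}^{p\times p}$, $$\hat{\boldsymbol{\Sigma}}_{\mathrm{TWE}}(\{\mathbf{A}\mathbf{x}_i\}) = \mathbf{A}\,\hat{\boldsymbol{\Sigma}}_{\mathrm{TWE}}(\{\mathbf{x}_i\})\,\mathbf{A}^\top .$$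
   Context: For data $\mathbf{x}_1,\ldots,\mathbf{x}_n \in \mathbb{R}^p$, Tyler's M-estimator $\hat{\boldsymbol{\Sigma}} = \hat{\boldsymbol{\Sigma}}(\{\mathbf{x}_i\})$ is the symmetric positive definite solution of the fixed-point equation $$\hat{\boldsymbol{\Sigma}} = \frac{1}{n}\sum_{i=1}^n \frac{p}{\mathbf{x}_i^\top \hat{\boldsymbol{\Sigma}}^{-1}\mathbf{x}_i}\,\mathbf{x}_i\mathbf{x}_i^\top,$$ which is unique only up to a positive scaling factor, normalized so that $\operatorname{tr}(\hat{\boldsymbol{\Sigma}}) = p$. Tyler's weights are $\hat w_i = p/(\mathbf{x}_i^\top\hat{\boldsymbol{\Sigma}}^{-1}\mathbf{x}_i)$, $i=1,\ldots,n$, computed with this normalized $\hat{\boldsymbol{\Sigma}}$. The Tyler's weights-based estimate (TWE) of scale is $$\hat\eta_{\mathrm{TWE}} = \Big(\frac{1}{n}\sum_{i=1}^n \hat w_i\Big)^{-1} = \Big(\frac{p}{n}\sum_{i=1}^n [\mathbf{x}_i^\top\hat{\boldsymbol{\Sigma}}^{-1}\mathbf{x}_i]^{-1}\Big)^{-1},$$ and the TWE of the scatter matrix is $$\hat{\boldsymbol{\Sigma}}_{\mathrm{TWE}} = \hat\eta_{\mathrm{TWE}}\cdot\hat{\boldsymbol{\Sigma}}.$$ The notation $\hat{\boldsymbol{\Sigma}}_{\mathrm{TWE}}(\{\mathbf{A}\mathbf{x}_i\})$ means that all of these quantities (the trace-normalized Tyler's M-estimator, its weights, and the scale estimate) are computed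 from the transformed data $\mathbf{A}\mathbf{x}_1,\ldots,\mathbf{A}\mathbf{x}_n$. *)

theory Defs
  imports "HOL-Analysis.Analysis"
begin

definition outer_self :: "real ^ 'p \<Rightarrow> real ^ 'p ^ 'p"
  where "outer_self v = (\<chi> i j. v $ i * v $ j)"

definition sym_pos_def :: "real ^ 'p ^ 'p \<Rightarrow> bool"
  where "sym_pos_def V \<longleftrightarrow> transpose V = V \<and> (\<forall>v. v \<noteq> 0 \<longrightarrow> 0 < v \<bullet> (V *v v))"

definition tyler_weight :: "real ^ 'p ^ 'p \<Rightarrow> real ^ 'p \<Rightarrow> real"
  where "tyler_weight V v = real CARD('p) / (v \<bullet> (matrix_inv V *v v))"

text \<open>A sample of \<open>n\<close> points in dimension \<open>p\<close> is a family \<open>x :: 'n \<Rightarrow> real ^ 'p\<close> with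
  \<open>n = CARD('n)\<close> and \<open>p = CARD('p)\<close>.\<close>

definition tyler_solution :: "('n::finite \<Rightarrow> real ^ 'p) \<Rightarrow> real ^ 'p ^ 'p \<Rightarrow> bool"
  where "tyler_solution x V \<longleftrightarrow> sym_pos_def V \<and>
    V = (1 / real CARD('n)) *\<^sub>R (\<Sum>i\<in>UNIV. tyler_weight V (x i) *\<^sub>R outer_self (x i))"

text \<open>The description below is meaningful only when \<open>tyler_solution x\<close> is solvable, uniquely up to
  a positive factor; otherwise its value is unspecified.\<close>

definition tyler_estimator :: "('n::finite \<Rightarrow> real ^ 'p) \<Rightarrow> real ^ 'p ^ 'p"
  where "tyler_estimator x = (THE V. tyler_solution x V \<and> trace V = real CARD('p))"

definition twe_scale :: "('n::finite \<Rightarrow> real ^ 'p) \<Rightarrow> real"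
  where "twe_scale x =
    inverse ((1 / real CARD('n)) * (\<Sum>i\<in>UNIV. tyler_weight (tyler_estimator x) (x i)))"

definition twe_scatter :: "('n::finite \<Rightarrow> real ^ 'p) \<Rightarrow> real ^ 'p ^ 'p"
  where "twe_scatter x = twe_scale x *\<^sub>R tyler_estimator x"

end

theory Submission
  imports Defs
begin

text \<open>Up to scaling, the congruence \<open>V \<mapsto> A V A\<^sup>T\<close> maps the Tyler solutions of the data \<open>x\<close>
  bijectively onto those of \<open>A x\<close> and preserves the weights. A positive rescaling of \<open>V\<close> rescales
  the weights by the same factor, so \<open>V\<close> divided by its mean weight is the same matrix for every
  solution \<open>V\<close>. This matrix is the TWE, and the trace normalization plays no role in it.\<close>

lemma sym_pos_def_invertible:
  fixes V :: "real ^ 'p ^ 'p"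
  assumes "sym_pos_def V"
  shows "invertible V"
proof -
  have "v = 0" if "V *v v = 0" for v
    using assms that unfolding sym_pos_def_def by (metis inner_zero_right less_irrefl)
  then show ?thesis
    by (metis invertible_left_inverse matrix_left_invertible_ker)
qed

text \<open>The diagonal entries are the values of the quadratic form at the basis vectors.
  Positivity is what allows a solution to be rescaled to trace \<open>p\<close>.\<close>

lemma sym_pos_def_trace_pos:
  fixes V :: "real ^ 'p ^ 'p"
  assumes "sym_pos_def V"
  shows "0 < trace V"
proof -
  have "0 < V $ i $ i" for i
  proof -
    have "0 < axis i 1 \<bullet> (V *v axis i 1)"
      using assms unfolding sym_pos_def_def by (metis axis_eq_0_iff zero_neq_one)
    then show ?thesis
      by (simp add: matrix_vector_mult_basis inner_axis' column_def)
  qed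
  then show ?thesis
    unfolding trace_def by (simp add: sum_pos)
qed

lemma sym_pos_def_scaleR:
  fixes V :: "real ^ 'p ^ 'p"
  assumes "sym_pos_def V" "0 < c"
  shows "sym_pos_def (c *\<^sub>R V)"
  using assms by (simp add: sym_pos_def_def transpose_scalar flip: scaleR_matrix_vector_assoc)

lemma sym_pos_def_congruence:
  fixes A V :: "real ^ 'p ^ 'p"
  assumes "sym_pos_def V" "invertible A"
  shows "sym_pos_def (A ** V ** transpose A)"
proof -
  have "0 < v \<bullet> ((A ** V ** transpose A) *v v)" if "v \<noteq> 0" for v
  proof -
    have "invertible (transpose A)"
      using assms(2) by (simp add: transpose_invertible)
    then have "transpose A *v v \<noteq> 0"
      using that by (metis invertible_left_inverse matrix_left_invertible_ker)
    then have "0 < (transpose A *v v) \<bullet> (V *v (transpose A *v v))"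
      using assms(1) unfolding sym_pos_def_def by blast
    then show ?thesis
      by (simp add: dot_lmul_matrix flip: matrix_vector_mul_assoc)
  qed
  then show ?thesis
    using assms(1) by (simp add: sym_pos_def_def matrix_transpose_mul matrix_mul_assoc)
qed

text \<open>Evaluates inverses pointwise: a preimage of \<open>v\<close> under \<open>V\<close>
  determines the quadratic form in \<open>tyler_weight\<close>, so no formula for the inverse of a
  product is called for.\<close>

lemma matrix_inv_mult_vector_unique:
  fixes V :: "real ^ 'p ^ 'p"
  assumes "invertible V" "V *v u = v"
  shows "matrix_inv V *v v = u"
proof -
  have "matrix_inv V ** V = mat 1"
    using assms(1) unfolding invertible_def matrix_inv_def by (rule someI2_ex) simp
  then show ?thesis
    using assms(2) by (metis matrix_vector_mul_assoc matrix_vector_mul_lid)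
qed

lemma invertible_obtain_preimage:
  fixes V :: "real ^ 'p ^ 'p"
  assumes "invertible V"
  obtains u where "V *v u = v"
  using assms by (metis invertible_def matrix_vector_mul_assoc matrix_vector_mul_lid)

lemma tyler_weight_scaleR:
  fixes V :: "real ^ 'p ^ 'p"
  assumes "sym_pos_def V" "0 < c"
  shows "tyler_weight (c *\<^sub>R V) v = c * tyler_weight V v"
proof -
  obtain u where u: "V *v u = v"
    using sym_pos_def_invertible[OF assms(1)] by (rule invertible_obtain_preimage)
  have "matrix_inv V *v v = u"
    using matrix_inv_mult_vector_unique[OF sym_pos_def_invertible[OF assms(1)] u] .
  moreover have "matrix_inv (c *\<^sub>R V) *v v = inverse c *\<^sub>R u"
    using u assms(2)
    by (intro matrix_inv_mult_vector_unique sym_pos_def_invertible sym_pos_def_scaleR assms)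
      (simp add: matrix_vector_mult_scaleR flip: scaleR_matrix_vector_assoc)
  ultimately show ?thesis
    using assms(2) by (simp add: tyler_weight_def field_simps)
qed

text \<open>With \<open>V u = v\<close> and \<open>transpose A z = u\<close>, the vector
  \<open>z\<close> is the preimage of \<open>A v\<close> under the congruent matrix. Moving
  \<open>A\<close> across the inner product turns \<open>(A v) \<bullet> z\<close> into
  \<open>v \<bullet> u\<close>, so both quadratic forms agree.\<close>

lemma tyler_weight_congruence:
  fixes A V :: "real ^ 'p ^ 'p"
  assumes "sym_pos_def V" "invertible A"
  shows "tyler_weight (A ** V ** transpose A) (A *v v) = tyler_weight V v"
proof -
  have "invertible (transpose A)"
    using assms(2) by (simp add: transpose_invertible)
  obtain u where u: "V *v u = v"
    using sym_pos_def_invertible[OF assms(1)] by (rule invertible_obtain_preimage)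
  obtain z where z: "transpose A *v z = u"
    using \<open>invertible (transpose A)\<close> by (rule invertible_obtain_preimage)
  have "(A ** V ** transpose A) *v z = A *v v"
    using u z by (metis matrix_vector_mul_assoc)
  then have "matrix_inv (A ** V ** transpose A) *v (A *v v) = z"
    by (intro matrix_inv_mult_vector_unique sym_pos_def_invertible sym_pos_def_congruence assms)
  moreover have "matrix_inv V *v v = u"
    using matrix_inv_mult_vector_unique[OF sym_pos_def_invertible[OF assms(1)] u] .
  moreover have "(A *v v) \<bullet> z = v \<bullet> u"
    using z by (metis dot_lmul_matrix inner_commute transpose_matrix_vector)
  ultimately show ?thesis
    by (simp add: tyler_weight_def)
qed

lemma outer_self_matrix_vector_mult:
  fixes A :: "real ^ 'p ^ 'p"
  shows "outer_self (A *v v) = A ** outer_self v ** transpose A"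
  by (simp add: vec_eq_iff outer_self_def matrix_matrix_mult_def matrix_vector_mult_def
      transpose_def sum_product sum_distrib_left sum_distrib_right mult_ac)

text \<open>Lets a congruence pass through the scalars and the sum in the fixed-point
  equation.\<close>

lemma linear_congruence:
  fixes A :: "real ^ 'p ^ 'p"
  shows "linear (\<lambda>M. A ** M ** transpose A)"
  by (rule linearI)
    (simp_all add: vec_eq_iff matrix_matrix_mult_def sum_distrib_left sum_distrib_right
      sum.distrib algebra_simps)

text \<open>Both sides of the fixed-point equation are homogeneous of degree one in
  \<open>V\<close>: the weights pick up the factor \<open>c\<close>, and the outer products depend
  on the data alone.\<close>

lemma tyler_solution_scaleR:
  fixes x :: "'n::finite \<Rightarrow> real ^ 'p"
  assumes "tyler_solution x V" "0 < c"
  shows "tyler_solution x (c *\<^sub>R V)"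
proof -
  have spd: "sym_pos_def V"
    and eq: "V = (1 / real CARD('n)) *\<^sub>R (\<Sum>i\<in>UNIV. tyler_weight V (x i) *\<^sub>R outer_self (x i))"
    using assms(1) unfolding tyler_solution_def by blast+
  have "c *\<^sub>R V =
      (1 / real CARD('n)) *\<^sub>R (\<Sum>i\<in>UNIV. (c * tyler_weight V (x i)) *\<^sub>R outer_self (x i))"
    by (subst eq) (simp add: scaleR_sum_right mult.left_commute)
  then show ?thesis
    unfolding tyler_solution_def tyler_weight_scaleR[OF spd assms(2)]
    by (intro conjI sym_pos_def_scaleR spd assms(2))
qed

lemma tyler_solution_congruence:
  fixes x :: "'n::finite \<Rightarrow> real ^ 'p" and A :: "real ^ 'p ^ 'p"
  assumes "tyler_solution x V" "invertible A"
  shows "tyler_solution (\<lambda>i. A *v x i) (A ** V ** transpose A)"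
proof -
  have spd: "sym_pos_def V"
    and eq: "V = (1 / real CARD('n)) *\<^sub>R (\<Sum>i\<in>UNIV. tyler_weight V (x i) *\<^sub>R outer_self (x i))"
    using assms(1) unfolding tyler_solution_def by blast+
  have "A ** V ** transpose A = (1 / real CARD('n)) *\<^sub>R
      (\<Sum>i\<in>UNIV. tyler_weight V (x i) *\<^sub>R outer_self (A *v x i))"
    by (subst eq) (simp only: linear_cmul[OF linear_congruence] linear_sum[OF linear_congruence]
        outer_self_matrix_vector_mult)
  then show ?thesis
    unfolding tyler_solution_def tyler_weight_congruence[OF spd assms(2)]
    by (intro conjI sym_pos_def_congruence spd assms(2))
qed

text \<open>Uniqueness is kept apart from existence, since the two are carried over to the
  transformed data by different arguments.\<close>

definition tyler_unique :: "('n::finite \<Rightarrow> real ^ 'p) \<Rightarrow> bool"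
  where "tyler_unique x \<longleftrightarrow>
    (\<forall>V W. tyler_solution x V \<longrightarrow> tyler_solution x W \<longrightarrow> (\<exists>c>0. W = c *\<^sub>R V))"

text \<open>The definite description in \<open>tyler_estimator\<close> also has to be meaningful for
  the transformed data. Two solutions there are pulled back along the inverse of \<open>A\<close>,
  compared as solutions for \<open>x\<close>, and pushed forward again.\<close>

lemma tyler_unique_matrix_vector_mult:
  fixes x :: "'n::finite \<Rightarrow> real ^ 'p" and A :: "real ^ 'p ^ 'p"
  assumes "tyler_unique x" "invertible A"
  shows "tyler_unique (\<lambda>i. A *v x i)"
  unfolding tyler_unique_def
proof (intro allI impI)
  fix V W
  assume V: "tyler_solution (\<lambda>i. A *v x i) V" and W: "tyler_solution (\<lambda>i. A *v x i) W"
  obtain B where AB: "A ** B = mat 1" and BA: "B ** A = mat 1"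
    using assms(2) unfolding invertible_def by blast
  have pull: "tyler_solution x (B ** U ** transpose B)"
    if "tyler_solution (\<lambda>i. A *v x i) U" for U
    \<comment> \<open>The congruence lemma is applied to the transformed data with \<open>B\<close>,
      and \<open>B ** A = mat 1\<close> returns the data to \<open>x\<close>.\<close>
    using tyler_solution_congruence[OF that, of B] AB BA
    by (auto simp: invertible_def matrix_vector_mul_assoc)
  have push: "A ** (B ** U ** transpose B) ** transpose A = U" for U
  proof -
    have "A ** (B ** U ** transpose B) ** transpose A = (A ** B) ** U ** transpose (A ** B)"
      by (simp add: matrix_transpose_mul matrix_mul_assoc)
    then show ?thesis
      by (simp add: AB)
  qed
  obtain c where "c > 0" and c: "B ** W ** transpose B = c *\<^sub>R (B ** V ** transpose B)"
    using assms(1) pull[OF V] pull[OF W] unfolding tyler_unique_def by blast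
  have "W = A ** (c *\<^sub>R (B ** V ** transpose B)) ** transpose A"
    using push[of W] by (simp only: c)
  also have "\<dots> = c *\<^sub>R V"
    using linear_cmul[OF linear_congruence[of A], of c "B ** V ** transpose B"] by (simp only: push)
  finally show "\<exists>c>0. W = c *\<^sub>R V"
    using \<open>c > 0\<close> by blast
qed

text \<open>Any solution computes the TWE: the factor \<open>c\<close> that normalizes the trace
  also multiplies the mean weight, whose inverse cancels it.\<close>

lemma twe_scatter_eq:
  fixes x :: "'n::finite \<Rightarrow> real ^ 'p"
  assumes V: "tyler_solution x V" and unique: "tyler_unique x"
  shows "twe_scatter x =
    inverse ((1 / real CARD('n)) * (\<Sum>i\<in>UNIV. tyler_weight V (x i))) *\<^sub>R V"
proof -
  have spd: "sym_pos_def V"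
    using V unfolding tyler_solution_def by blast
  define c where "c = real CARD('p) / trace V"
  have "0 < c"
    using sym_pos_def_trace_pos[OF spd] by (simp add: c_def)
  have trace_scaleR: "trace (k *\<^sub>R V) = k * trace V" for k
    by (simp add: trace_def sum_distrib_left)
  have "tyler_estimator x = c *\<^sub>R V"
    unfolding tyler_estimator_def
  proof (rule the_equality)
    show "tyler_solution x (c *\<^sub>R V) \<and> trace (c *\<^sub>R V) = real CARD('p)"
      using sym_pos_def_trace_pos[OF spd] tyler_solution_scaleR[OF V \<open>0 < c\<close>]
      by (simp add: trace_scaleR c_def)
  next
    fix W
    assume W: "tyler_solution x W \<and> trace W = real CARD('p)"
    then obtain d where d: "W = d *\<^sub>R V"
      using unique V unfolding tyler_unique_def by blast
    then have "d * trace V = real CARD('p)"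
      using W by (simp add: trace_scaleR)
    then show "W = c *\<^sub>R V"
      using sym_pos_def_trace_pos[OF spd] d by (simp add: c_def field_simps)
  qed
  then show ?thesis
    using \<open>0 < c\<close> spd
    by (simp add: twe_scatter_def twe_scale_def tyler_weight_scaleR flip: sum_distrib_left)
qed

theorem lemma1:
  fixes x :: "'n::finite \<Rightarrow> real ^ 'p" and A :: "real ^ 'p ^ 'p"
  assumes "\<And>i. x i \<noteq> 0"
    and "\<exists>V. tyler_solution x V"
    and "\<And>V W. tyler_solution x V \<Longrightarrow> tyler_solution x W \<Longrightarrow> \<exists>c>0. W = c *\<^sub>R V"
    and "invertible A"
  shows "twe_scatter (\<lambda>i. A *v x i) = A ** twe_scatter x ** transpose A"
proof -
  obtain V where V: "tyler_solution x V"
    using assms(2) by blast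
  then have spd: "sym_pos_def V"
    unfolding tyler_solution_def by blast
  have unique: "tyler_unique x"
    using assms(3) unfolding tyler_unique_def by blast
  show ?thesis
    \<comment> \<open>Using \<open>V\<close> for \<open>x\<close> and its congruent image for the
      transformed data gives both sides the same scalar, because the weights agree; only homogeneity
      of the congruence remains.\<close>
    unfolding twe_scatter_eq[OF V unique]
      twe_scatter_eq[OF tyler_solution_congruence[OF V assms(4)]
        tyler_unique_matrix_vector_mult[OF unique assms(4)]]
      tyler_weight_congruence[OF spd assms(4)]
    by (rule linear_cmul[OF linear_congruence, symmetric])
qed

end
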